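(* Let $f(x)\in\mathbb{Z}[x]$ have degree $d\ge 2$ and let $t\in\mathbb{Z}$ be a wandering point for $f$. Let $g_1(x),\dots,g_k(x)$ be finitely many monic linear polynomials in $\mathbb{Z}[x]$. Then the following statements are equivalent: (i) $\delta_{f,t}\left(\bigcup_{i=1}^k \operatorname{Orb}^{\pm}_{g_i}(t)\right)=1$; (ii) $\delta_{f,t}\left(\operatorname{Orb}^{\pm}_{g_i}(t)\right)=1$ for some $i$ with $1\le i\le k$; (iii) $\operatorname{Orb}_f(t)\subset \operatorname{Orb}^{\pm}_{g_i}(t)$ for some $i$ with $1\le i\le k$.
   Context: For a polynomial $f$ and a point $t$, $f^0(x)=x$, $f^n=f\circ f^{n-1}$, and $\operatorname{Orb}_f(t)=\{f^n(t): n\ge 0\}$. The point $t$ is a wandering point for $f$ if $\operatorname{Orb}_f(t)$ is infinite. For a monic linear polynomial $g(x)=x+a$ with $a\in\mathbb{Z}$, $\operatorname{Orb}^{\pm}_g(t)=\{g^n(t):n\in\mathbb{Z}\}=\{t+na: n\in\mathbb{Z}\}$ (union of forward and backward orbits). For $f\in\mathbb{Z}[x]$, $s\in\mathbb{Z}$ and $A\subseteq\mathbb{Z}$, the relative density of $A$ in the orbit of $s$ under $f$ is $$\delta_{f,s}(A)=\lim_{X\to\infty}\frac{|\{x\in A\cap \operatorname{Orb}_f(s): x\le X\}|}{|\{x\in\operatorname{Orb}_f(s): x\le X\}|},$$ provided this limit exists.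
   Formalization: The relative density counts orbit points with |x| ≤ X instead of x ≤ X, since for orbits with infinitely many negative terms (e.g. f = −x², t = 2) the original counts are infinite and the density is undefined; the two agree whenever the original counts are finite. *)

theory Defs
  imports Complex_Main "HOL-Computational_Algebra.Polynomial"
begin

definition orbit :: "int poly \<Rightarrow> int \<Rightarrow> int set" where
  "orbit f t = {(poly f ^^ n) t | n. True}"

definition wandering_point :: "int poly \<Rightarrow> int \<Rightarrow> bool" where
  "wandering_point f t \<longleftrightarrow> infinite (orbit f t)"

definition monic_linear :: "int poly \<Rightarrow> bool" where
  "monic_linear g \<longleftrightarrow> degree g = 1 \<and> lead_coeff g = 1"

definition backward_orbit :: "int poly \<Rightarrow> int \<Rightarrow> int set" where
  "backward_orbit g t = {x. \<exists>n. (poly g ^^ n) x = t}"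

definition two_sided_orbit :: "int poly \<Rightarrow> int \<Rightarrow> int set" where
  "two_sided_orbit g t = orbit g t \<union> backward_orbit g t"

lemma funpow_shift: "(poly [:a, 1:] ^^ n) t = t + int n * (a::int)"
  by (induction n) (simp_all add: algebra_simps)

lemma two_sided_orbit_shift: "two_sided_orbit [:a, 1:] t = {t + n * a | n. True}"
proof -
  have "t + m * a \<in> two_sided_orbit [:a, 1:] t" for m :: int
  proof (cases "m \<ge> 0")
    case True
    then have "t + m * a = t + int (nat m) * a" by simp
    then show ?thesis
      unfolding two_sided_orbit_def orbit_def funpow_shift by blast
  next
    case False
    then have "t + m * a + int (nat (- m)) * a = t" by (simp add: algebra_simps)
    then show ?thesis
      unfolding two_sided_orbit_def backward_orbit_def funpow_shift by blast
  qed
  moreover have "\<exists>m. x = t + m * a" if x: "x \<in> two_sided_orbit [:a, 1:] t" for x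
  proof -
    from x consider n where "x = t + int n * a" | n where "x + int n * a = t"
      unfolding two_sided_orbit_def orbit_def backward_orbit_def funpow_shift by blast
    then show ?thesis
    proof cases
      case 1
      then show ?thesis by blast
    next
      case (2 n)
      then have "x = t + (- int n) * a" by simp
      then show ?thesis by blast
    qed
  qed
  ultimately show ?thesis by blast
qed

text \<open>
  \<open>has_rel_density f s A d\<close> says that the limit defining \<open>\<delta>\<^bsub>f,s\<^esub>(A)\<close> exists and equals \<open>d\<close>.
  Orbit points are counted by absolute value: a condition \<open>x \<le> X\<close> would give an
  infinite count (a meaningless quotient) for orbits with infinitely many negative terms, such as
  that of \<open>2\<close> under \<open>-x\<^sup>2\<close>. Whenever the counts with \<open>x \<le> X\<close> are finite, both versions agree;
  see \<open>has_rel_density_iff_le\<close>.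
\<close>

definition has_rel_density :: "int poly \<Rightarrow> int \<Rightarrow> int set \<Rightarrow> real \<Rightarrow> bool" where
  "has_rel_density f s A d \<longleftrightarrow>
     ((\<lambda>X::real. real (card {x \<in> A \<inter> orbit f s. real_of_int \<bar>x\<bar> \<le> X}) /
                 real (card {x \<in> orbit f s. real_of_int \<bar>x\<bar> \<le> X})) \<longlongrightarrow> d) at_top"

lemma has_rel_density_iff_le:
  assumes fin: "\<And>X::real. finite {x \<in> orbit f s. real_of_int x \<le> X}"
  shows "has_rel_density f s A d \<longleftrightarrow>
     ((\<lambda>X::real. real (card {x \<in> A \<inter> orbit f s. real_of_int x \<le> X}) /
                 real (card {x \<in> orbit f s. real_of_int x \<le> X})) \<longlongrightarrow> d) at_top"
proof -
  let ?N = "{x \<in> orbit f s. real_of_int x \<le> 0}"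
  obtain B where B: "\<And>x. x \<in> ?N \<Longrightarrow> - x \<le> B"
    using bdd_above_finite[of "uminus ` ?N"] fin[of 0]
    by (auto simp: bdd_above_def)
  have eq: "(real_of_int \<bar>x\<bar> \<le> X) = (real_of_int x \<le> X)"
    if "X \<ge> real_of_int B" "x \<in> orbit f s" for X :: real and x
  proof (cases "x \<le> 0")
    case True
    with B[of x] that have "- x \<le> B" by simp
    then have "real_of_int (- x) \<le> real_of_int B" by (simp only: of_int_le_iff)
    with True that show ?thesis by simp
  qed simp
  have "eventually (\<lambda>X::real.
      real (card {x \<in> A \<inter> orbit f s. real_of_int \<bar>x\<bar> \<le> X}) /
        real (card {x \<in> orbit f s. real_of_int \<bar>x\<bar> \<le> X}) =
      real (card {x \<in> A \<inter> orbit f s. real_of_int x \<le> X}) /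
        real (card {x \<in> orbit f s. real_of_int x \<le> X})) at_top"
    using eventually_ge_at_top[of "real_of_int B"]
  proof eventually_elim
    case (elim X)
    have "{x \<in> A \<inter> orbit f s. real_of_int \<bar>x\<bar> \<le> X} = {x \<in> A \<inter> orbit f s. real_of_int x \<le> X}"
         "{x \<in> orbit f s. real_of_int \<bar>x\<bar> \<le> X} = {x \<in> orbit f s. real_of_int x \<le> X}"
      using eq[OF elim] by blast+
    then show ?case by (simp only:)
  qed
  then show ?thesis
    unfolding has_rel_density_def by (rule tendsto_cong)
qed

end

theory Submission
  imports Defs "HOL-Number_Theory.Cong"
begin

text \<open>
  Membership of \<open>x\<close> in the two-sided orbit of \<open>t\<close> under \<open>x + a\<close> means \<open>x \<equiv> t (mod a)\<close>. If the
  \<open>f\<close>-orbit of \<open>t\<close> ever returns to \<open>t\<close> modulo \<open>a\<close>, it is purely periodic modulo \<open>a\<close>. Taking a common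
  period \<open>P\<close> of all moduli for which this happens, \<open>f\<^sup>1\<^sup>+\<^sup>j\<^sup>P(t) \<equiv> t (mod a)\<close> forces \<open>f(t) \<equiv> t (mod a)\<close>,
  and then the whole orbit lies in one residue class. Hence, if no residue class
  contains the orbit, the union misses every iterate with index \<open>1 + jP\<close>. As \<open>|f\<^sup>n(t)|\<close> is
  eventually strictly increasing, these make up a fraction of at least \<open>1/(P+1)\<close> of
  the orbit points of absolute value at most \<open>|f\<^sup>m\<^sup>P(t)|\<close>.
\<close>

section \<open>Orbits as sets of integers\<close>

lemma orbit_eq_range: "orbit f t = range (\<lambda>n. (poly f ^^ n) t)"
  by (auto simp: orbit_def)

lemma finite_orbit_abs_le: "finite {x \<in> orbit f t. real_of_int \<bar>x\<bar> \<le> X}"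
proof (rule finite_subset)
  show "{x \<in> orbit f t. real_of_int \<bar>x\<bar> \<le> X} \<subseteq> {- \<lfloor>X\<rfloor>..\<lfloor>X\<rfloor>}"
    by (auto simp: abs_le_iff le_floor_iff) linarith
qed simp

text \<open>The constant term may be \<open>0\<close>: congruence modulo \<open>0\<close> is
  equality, which matches the orbit \<open>{t}\<close> of the identity.\<close>

lemma two_sided_orbit_eq_residue_class:
  assumes "monic_linear g"
  shows "two_sided_orbit g t = {x. [x = t] (mod coeff g 0)}"
proof -
  have "g = [:coeff g 0, 1:]"
  proof (rule poly_eqI)
    fix n :: nat
    consider "n = 0" | "n = 1" | "n > 1" by linarith
    then show "coeff g n = coeff [:coeff g 0, 1:] n"
      using assms by cases (auto simp: monic_linear_def coeff_eq_0 coeff_pCons split: nat.splits)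
  qed
  then have "two_sided_orbit g t = {t + n * coeff g 0 | n. True}"
    by (metis two_sided_orbit_shift)
  also have "\<dots> = {x. [x = t] (mod coeff g 0)}"
    by (auto simp: cong_iff_dvd_diff dvd_def algebra_simps)
  finally show ?thesis .
qed

section \<open>Growth of the iterates in absolute value\<close>

lemma abs_poly_gt:
  fixes f :: "int poly"
  assumes "degree f \<ge> 2"
  obtains R where "\<And>x. \<bar>x\<bar> \<ge> R \<Longrightarrow> \<bar>poly f x\<bar> > \<bar>x\<bar>"
proof -
  \<comment> \<open>Here \<open>f(x) = a + x (b + x q(x))\<close> with \<open>q\<close> nonzero by
    the degree bound. Away from the finitely many roots of \<open>q\<close>, the integer
    \<open>|q(x)|\<close> is at least 1.\<close>
  obtain a b q where f: "f = pCons a (pCons b q)"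
    by (metis pCons_cases)
  have "q \<noteq> 0"
    using assms by (auto simp: f split: if_splits)
  then obtain B where B: "\<And>x. poly q x = 0 \<Longrightarrow> \<bar>x\<bar> \<le> B"
    using bdd_above_finite[of "abs ` {x. poly q x = 0}"] poly_roots_finite[of q]
    by (auto simp: bdd_above_def)
  show ?thesis
  proof
    fix x :: int
    \<comment> \<open>\<open>B + 1\<close> avoids the roots of \<open>q\<close>; the other bound
      gives \<open>|b + x q(x)| >= |a| + 2\<close>, so that the product with \<open>x\<close>
      exceeds \<open>|a| + |x|\<close>.\<close>
    assume x: "\<bar>x\<bar> \<ge> max (B + 1) (\<bar>a\<bar> + \<bar>b\<bar> + 2)"
    have "poly q x \<noteq> 0"
      using B[of x] x by auto
    then have "\<bar>x\<bar> * 1 \<le> \<bar>x\<bar> * \<bar>poly q x\<bar>"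
      by (intro mult_left_mono) auto
    then have "\<bar>x\<bar> \<le> \<bar>x * poly q x\<bar>"
      by (simp add: abs_mult)
    then have "\<bar>a\<bar> + 2 \<le> \<bar>b + x * poly q x\<bar>"
      using x by linarith
    then have "\<bar>x\<bar> * (\<bar>a\<bar> + 2) \<le> \<bar>x\<bar> * \<bar>b + x * poly q x\<bar>"
      by (intro mult_left_mono) auto
    moreover have "1 * \<bar>a\<bar> \<le> \<bar>x\<bar> * \<bar>a\<bar>"
      using x by (intro mult_right_mono) auto
    ultimately have "\<bar>a\<bar> + \<bar>x\<bar> < \<bar>x * (b + x * poly q x)\<bar>"
      using x unfolding abs_mult[of x] distrib_left[of "\<bar>x\<bar>"] by linarith
    then show "\<bar>poly f x\<bar> > \<bar>x\<bar>"
      by (simp add: f)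
  qed
qed

text \<open>An infinite set of integers leaves every bounded interval. Once an iterate is so large
  that \<open>f\<close> increases absolute values, all later ones stay in that range.\<close>

lemma wandering_abs_iterates_increasing:
  assumes "degree f \<ge> 2" "wandering_point f t"
  obtains N where "\<And>n m. N \<le> n \<Longrightarrow> n < m \<Longrightarrow> \<bar>(poly f ^^ n) t\<bar> < \<bar>(poly f ^^ m) t\<bar>"
proof -
  let ?h = "\<lambda>n. (poly f ^^ n) t"
  obtain R where R: "\<And>x. \<bar>x\<bar> \<ge> R \<Longrightarrow> \<bar>poly f x\<bar> > \<bar>x\<bar>"
    using abs_poly_gt[OF assms(1)] by blast
  have "\<not> range ?h \<subseteq> {-R..R}"
    using assms(2) finite_subset unfolding wandering_point_def orbit_eq_range by blast
  then obtain N where "?h N \<notin> {-R..R}"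
    by blast
  then have N: "\<bar>?h N\<bar> \<ge> R"
    by auto
  have large: "\<bar>?h (N + k)\<bar> \<ge> R" for k
  proof (induction k)
    case (Suc k)
    then show ?case using R[of "?h (N + k)"] by simp
  qed (use N in simp)
  have "strict_mono (\<lambda>k. \<bar>?h (N + k)\<bar>)"
    unfolding strict_mono_Suc_iff using R[OF large] by simp
  then have "\<bar>?h n\<bar> < \<bar>?h m\<bar>" if "N \<le> n" "n < m" for n m
    using that strict_monoD[of "\<lambda>k. \<bar>?h (N + k)\<bar>" "n - N" "m - N"] by simp
  then show ?thesis
    using that by blast
qed

text \<open>A coincidence of two iterates would propagate to all later indices, where absolute
  values strictly increase.\<close>

lemma wandering_inj_iterates:
  assumes "degree f \<ge> 2" "wandering_point f t"
  shows "inj (\<lambda>n. (poly f ^^ n) t)"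
proof (rule linorder_injI)
  fix n m :: nat
  assume "n < m"
  obtain N where N: "\<And>n m. N \<le> n \<Longrightarrow> n < m \<Longrightarrow> \<bar>(poly f ^^ n) t\<bar> < \<bar>(poly f ^^ m) t\<bar>"
    using wandering_abs_iterates_increasing[OF assms] by blast
  have "(poly f ^^ (N + n)) t \<noteq> (poly f ^^ (N + m)) t"
    using N[of "N + n" "N + m"] \<open>n < m\<close> by auto
  then show "(poly f ^^ n) t \<noteq> (poly f ^^ m) t"
    by (auto simp: funpow_add)
qed

text \<open>This turns counting orbit points by size into counting indices.\<close>

lemma wandering_initial_segment:
  assumes "degree f \<ge> 2" "wandering_point f t"
  shows "\<forall>\<^sub>F M in sequentially.
    {x \<in> orbit f t. \<bar>x\<bar> \<le> \<bar>(poly f ^^ M) t\<bar>} = (\<lambda>n. (poly f ^^ n) t) ` {..M}"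
proof -
  let ?h = "\<lambda>n. (poly f ^^ n) t"
  obtain N where N: "\<And>n m. N \<le> n \<Longrightarrow> n < m \<Longrightarrow> \<bar>?h n\<bar> < \<bar>?h m\<bar>"
    using wandering_abs_iterates_increasing[OF assms] by blast
  have unbounded: "\<bar>?h (N + k)\<bar> \<ge> int k" for k
  proof (induction k)
    case (Suc k)
    then show ?case using N[of "N + k" "N + Suc k"] by simp
  qed simp
  obtain C where C: "\<And>n. n \<le> N \<Longrightarrow> \<bar>?h n\<bar> \<le> C"
    using bdd_above_finite[of "(\<lambda>n. \<bar>?h n\<bar>) ` {..N}"] by (auto simp: bdd_above_def)
  show ?thesis
    \<comment> \<open>The values up to index \<open>N\<close> may be irregular but are bounded by
      \<open>C\<close>. Growth by at least 1 per step beyond \<open>N\<close> has overtaken them by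
      index \<open>N + nat C\<close>.\<close>
    using eventually_ge_at_top[of "N + nat C"]
  proof eventually_elim
    case (elim M)
    have "\<bar>?h n\<bar> \<le> \<bar>?h M\<bar> \<longleftrightarrow> n \<le> M" for n
    proof
      assume "\<bar>?h n\<bar> \<le> \<bar>?h M\<bar>"
      then show "n \<le> M" using N[of M n] elim by (meson add_leD1 not_le)
    next
      assume "n \<le> M"
      show "\<bar>?h n\<bar> \<le> \<bar>?h M\<bar>"
      proof (cases "n \<le> N")
        case True
        have "C \<le> \<bar>?h M\<bar>"
          using unbounded[of "M - N"] elim by simp
        then show ?thesis using C[OF True] by linarith
      next
        case False
        then show ?thesis using N[of n M] \<open>n \<le> M\<close> by (cases "n = M") auto
      qed
    qed
    then show ?case
      by (auto simp: orbit_eq_range)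
  qed
qed

section \<open>Criteria for relative density one\<close>

lemma has_rel_density_one_if_orbit_subset:
  assumes "orbit f t \<subseteq> A"
  shows "has_rel_density f t A 1"
  unfolding has_rel_density_def
proof (rule tendsto_eventually)
  show "\<forall>\<^sub>F X in at_top. real (card {x \<in> A \<inter> orbit f t. real_of_int \<bar>x\<bar> \<le> X}) /
      real (card {x \<in> orbit f t. real_of_int \<bar>x\<bar> \<le> X}) = 1"
    \<comment> \<open>From here on \<open>t\<close> itself is counted, so the quotient is not the
      default value \<open>0\<close> of division by zero.\<close>
    using eventually_ge_at_top[of "real_of_int \<bar>t\<bar>"]
  proof eventually_elim
    case (elim X)
    have "t \<in> {x \<in> orbit f t. real_of_int \<bar>x\<bar> \<le> X}"
      using elim by (auto simp: orbit_def intro: exI[of _ 0])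
    then have "card {x \<in> orbit f t. real_of_int \<bar>x\<bar> \<le> X} \<noteq> 0"
      using finite_orbit_abs_le[of f t X] by (auto simp only: card_eq_0_iff)
    moreover have "A \<inter> orbit f t = orbit f t"
      using assms by blast
    ultimately show ?case
      by simp
  qed
qed

lemma not_has_rel_density_one_if_progression_missed:
  assumes f: "degree f \<ge> 2" "wandering_point f t"
    and P: "P > 0" and miss: "\<And>j. (poly f ^^ (1 + j * P)) t \<notin> A"
  shows "\<not> has_rel_density f t A 1"
proof
  let ?h = "\<lambda>n. (poly f ^^ n) t"
  let ?ratio = "\<lambda>X. real (card {x \<in> A \<inter> orbit f t. real_of_int \<bar>x\<bar> \<le> X}) /
      real (card {x \<in> orbit f t. real_of_int \<bar>x\<bar> \<le> X})"
  \<comment> \<open>The limit is tested along these cutoffs only: for large \<open>m\<close> exactly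
    \<open>m * P + 1\<close> orbit points are counted, of which the \<open>m\<close> iterates with
    index \<open>1 + j * P\<close>, \<open>j < m\<close>, are missed.\<close>
  let ?X = "\<lambda>m. real_of_int \<bar>?h (m * P)\<bar>"
  assume "has_rel_density f t A 1"
  then have lim: "(?ratio \<longlongrightarrow> 1) at_top"
    by (simp add: has_rel_density_def)
  have inj: "inj ?h"
    by (rule wandering_inj_iterates[OF f])
  obtain N where N: "\<And>n m. N \<le> n \<Longrightarrow> n < m \<Longrightarrow> \<bar>?h n\<bar> < \<bar>?h m\<bar>"
    using wandering_abs_iterates_increasing[OF f] by blast
  have growth: "real k \<le> real_of_int \<bar>?h (N + k)\<bar>" for k
  proof (induction k)
    case (Suc k)
    then show ?case using N[of "N + k" "N + Suc k"] by linarith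
  qed simp
  have lower: "- real N + real n \<le> real_of_int \<bar>?h n\<bar>" for n
    using growth[of "n - N"] by (cases "n \<le> N") (auto simp: of_nat_diff)
  have "filterlim (\<lambda>n. - real N + real n) at_top sequentially"
    by (intro filterlim_tendsto_add_at_top[OF tendsto_const] filterlim_real_sequentially)
  then have "filterlim (\<lambda>n. real_of_int \<bar>?h n\<bar>) at_top sequentially"
    by (rule filterlim_at_top_mono) (intro always_eventually allI lower)
  moreover have mP: "filterlim (\<lambda>m. m * P) sequentially sequentially"
    using P by (intro filterlim_subseq) (simp add: strict_mono_def)
  ultimately have "filterlim ?X at_top sequentially"
    by (rule filterlim_compose)
  with lim have lim': "(\<lambda>m. ?ratio (?X m)) \<longlonglongrightarrow> 1"
    by (rule filterlim_compose)
  have "\<forall>\<^sub>F m in sequentially. {x \<in> orbit f t. \<bar>x\<bar> \<le> \<bar>?h (m * P)\<bar>} = ?h ` {..m * P}"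
    using eventually_compose_filterlim[OF wandering_initial_segment[OF f] mP] .
  then have "\<forall>\<^sub>F m in sequentially. ?ratio (?X m) \<le> 1 - 1 / (real P + 1)"
    using eventually_gt_at_top[of 0]
  proof eventually_elim
    case (elim m)
    let ?J = "(\<lambda>j. 1 + j * P) ` {..<m}"
    have J: "?J \<subseteq> {..m * P}" "card ?J = m"
    proof -
      show "?J \<subseteq> {..m * P}"
      proof clarsimp
        fix j assume "j < m"
        then have "Suc j * P \<le> m * P" by (intro mult_right_mono) auto
        then show "Suc (j * P) \<le> m * P" using P by simp
      qed
      show "card ?J = m"
        using P by (subst card_image) (auto simp: inj_on_def)
    qed
    have seg: "{x \<in> orbit f t. real_of_int \<bar>x\<bar> \<le> ?X m} = ?h ` {..m * P}"
      using elim(1) by (simp only: of_int_le_iff)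
    then have "{x \<in> A \<inter> orbit f t. real_of_int \<bar>x\<bar> \<le> ?X m} = A \<inter> ?h ` {..m * P}"
      by blast
    also have "\<dots> \<subseteq> ?h ` ({..m * P} - ?J)"
      using miss by auto
    finally have "card {x \<in> A \<inter> orbit f t. real_of_int \<bar>x\<bar> \<le> ?X m} \<le> card ({..m * P} - ?J)"
      by (meson card_image_le card_mono finite_Diff finite_atMost finite_imageI le_trans)
    also have "\<dots> = m * P + 1 - m"
      using J by (subst card_Diff_subset) (auto intro: finite_subset)
    finally have "real (card {x \<in> A \<inter> orbit f t. real_of_int \<bar>x\<bar> \<le> ?X m}) \<le> real (m * P + 1 - m)"
      by linarith
    also have "real (m * P + 1 - m) = real (m * P + 1) - real m"
      using P by (intro of_nat_diff) (cases P, auto)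
    finally have num: "real (card {x \<in> A \<inter> orbit f t. real_of_int \<bar>x\<bar> \<le> ?X m})
        \<le> real (m * P + 1) - real m" .
    have den: "card {x \<in> orbit f t. real_of_int \<bar>x\<bar> \<le> ?X m} = m * P + 1"
      unfolding seg using inj by (simp add: card_image inj_on_subset)
    have "?ratio (?X m) \<le> (real (m * P + 1) - real m) / real (m * P + 1)"
      unfolding den by (intro divide_right_mono num) simp
    also have "\<dots> = 1 - real m / real (m * P + 1)"
      by (subst diff_divide_distrib, subst divide_self) (simp_all del: of_nat_add of_nat_mult)
    also have "\<dots> \<le> 1 - 1 / (real P + 1)"
    proof -
      \<comment> \<open>After clearing denominators this is just \<open>m >= 1\<close>.\<close>
      have "1 / (real P + 1) \<le> real m / real (m * P + 1)"
        using elim(2) add_pos_nonneg[of 1 "real P * real m"] by (simp add: field_simps)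
      then show ?thesis by simp
    qed
    finally show ?case .
  qed
  with lim' have "1 \<le> 1 - 1 / (real P + 1)"
    by (intro tendsto_upperbound) auto
  moreover have "1 / (real P + 1) > 0"
    by simp
  ultimately show False by linarith
qed

section \<open>Periodicity of the orbit modulo an integer\<close>

lemma cong_poly_iterate:
  fixes a x y :: int
  assumes "[x = y] (mod a)"
  shows "[(poly f ^^ n) x = (poly f ^^ n) y] (mod a)"
proof (induction n)
  case (Suc n)
  have "[poly f u = poly f v] (mod a)" if "[u = v] (mod a)" for u v
    by (induction f) (simp_all add: cong_add cong_mult that)
  with Suc show ?case by simp
qed (use assms in simp)

text \<open>Used twice below: with a return time \<open>p\<close> and \<open>n = 1\<close> to reduce
  the index \<open>1 + j * P\<close> to \<open>1\<close>, and with \<open>p = 1\<close>,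
  \<open>n = 0\<close> to spread a fixed residue over the whole orbit.\<close>

lemma cong_poly_iterate_period:
  fixes a t :: int
  assumes "[(poly f ^^ p) t = t] (mod a)"
  shows "[(poly f ^^ (n + j * p)) t = (poly f ^^ n) t] (mod a)"
proof (induction j)
  case (Suc j)
  have "[(poly f ^^ (n + j * p)) ((poly f ^^ p) t) = (poly f ^^ (n + j * p)) t] (mod a)"
    by (rule cong_poly_iterate[OF assms])
  then have "[(poly f ^^ (n + Suc j * p)) t = (poly f ^^ (n + j * p)) t] (mod a)"
    by (metis add.assoc add.commute comp_apply funpow_add mult_Suc)
  then show ?case using Suc by (rule cong_trans)
qed simp

lemma orbit_subset_residue_class_if_density_one:
  fixes a :: "'i \<Rightarrow> int"
  assumes f: "degree f \<ge> 2" "wandering_point f t" and fin: "finite I"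
    and dens: "has_rel_density f t (\<Union>i\<in>I. {x. [x = t] (mod a i)}) 1"
  shows "\<exists>i\<in>I. orbit f t \<subseteq> {x. [x = t] (mod a i)}"
proof -
  let ?h = "\<lambda>n. (poly f ^^ n) t"
  \<comment> \<open>If the orbit never returns to \<open>t\<close> modulo \<open>a i\<close>, any
    positive \<open>p i\<close> will do; the product of all \<open>p i\<close> is then
    positive.\<close>
  have "\<forall>i. \<exists>p>0. (\<exists>n>0. [?h n = t] (mod a i)) \<longrightarrow> [?h p = t] (mod a i)"
    by auto
  then obtain p where p: "\<And>i. p i > 0"
      "\<And>i n. n > 0 \<Longrightarrow> [?h n = t] (mod a i) \<Longrightarrow> [?h (p i) = t] (mod a i)"
    by metis
  let ?P = "\<Prod>i\<in>I. p i"
  have "?P > 0"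
    using p(1) by (simp add: prod_pos)
  then obtain j where "?h (1 + j * ?P) \<in> (\<Union>i\<in>I. {x. [x = t] (mod a i)})"
    using not_has_rel_density_one_if_progression_missed[OF f] dens by blast
  then obtain i where i: "i \<in> I" "[?h (1 + j * ?P) = t] (mod a i)"
    by blast
  \<comment> \<open>The index \<open>1 + j * ?P\<close> is positive, hence itself a return time, so
    \<open>p i\<close> is a genuine period.\<close>
  have per: "[?h (p i) = t] (mod a i)"
    using p(2)[OF _ i(2)] by simp
  have "p i dvd j * ?P"
    using fin i(1) by (intro dvd_mult dvd_prodI)
  then obtain c where "j * ?P = c * p i"
    by (metis dvd_def mult.commute)
  then have "[?h (1 + j * ?P) = ?h 1] (mod a i)"
    using cong_poly_iterate_period[OF per, of 1 c] by simp
  then have fixed: "[?h 1 = t] (mod a i)"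
    using i(2) cong_sym cong_trans by blast
  have "[?h n = t] (mod a i)" for n
    using cong_poly_iterate_period[OF fixed, of 0 n] by simp
  then show ?thesis
    using i(1) by (auto simp: orbit_eq_range)
qed

theorem theorem5p2:
  fixes f :: "int poly" and t :: int and k :: nat and g :: "nat \<Rightarrow> int poly"
  assumes "degree f \<ge> 2"
    and "wandering_point f t"
    and "\<And>i. i \<in> {1..k} \<Longrightarrow> monic_linear (g i)"
  shows "(has_rel_density f t (\<Union>i\<in>{1..k}. two_sided_orbit (g i) t) 1 \<longleftrightarrow>
            (\<exists>i\<in>{1..k}. has_rel_density f t (two_sided_orbit (g i) t) 1)) \<and>
         ((\<exists>i\<in>{1..k}. has_rel_density f t (two_sided_orbit (g i) t) 1) \<longleftrightarrow>
            (\<exists>i\<in>{1..k}. orbit f t \<subseteq> two_sided_orbit (g i) t))"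
proof -
  \<comment> \<open>A general \<open>I\<close> covers the full union and, as a singleton, each
    single two-sided orbit.\<close>
  have contained: "\<exists>i\<in>I. orbit f t \<subseteq> two_sided_orbit (g i) t"
    if I: "I \<subseteq> {1..k}" and dens: "has_rel_density f t (\<Union>i\<in>I. two_sided_orbit (g i) t) 1" for I
  proof -
    have eq: "two_sided_orbit (g i) t = {x. [x = t] (mod coeff (g i) 0)}" if "i \<in> I" for i
      using that I assms(3) by (intro two_sided_orbit_eq_residue_class) blast
    have "finite I"
      using I by (rule finite_subset) simp
    then have "\<exists>i\<in>I. orbit f t \<subseteq> {x. [x = t] (mod coeff (g i) 0)}"
      using dens eq by (intro orbit_subset_residue_class_if_density_one assms) (auto cong: SUP_cong)
    then show ?thesis
      using eq by blast
  qed
  let ?i = "has_rel_density f t (\<Union>i\<in>{1..k}. two_sided_orbit (g i) t) 1"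
  let ?ii = "\<exists>i\<in>{1..k}. has_rel_density f t (two_sided_orbit (g i) t) 1"
  let ?iii = "\<exists>i\<in>{1..k}. orbit f t \<subseteq> two_sided_orbit (g i) t"
  have "?i \<Longrightarrow> ?iii"
    using contained by blast
  moreover have "?iii" if ?ii
  proof -
    from that obtain i where "i \<in> {1..k}" "has_rel_density f t (two_sided_orbit (g i) t) 1"
      by blast
    then show ?thesis
      using contained[of "{i}"] by auto
  qed
  moreover have "?i \<and> ?ii" if ?iii
  proof -
    from that obtain i where i: "i \<in> {1..k}" "orbit f t \<subseteq> two_sided_orbit (g i) t"
      by blast
    then have "orbit f t \<subseteq> (\<Union>i\<in>{1..k}. two_sided_orbit (g i) t)"
      by blast
    then show ?thesis
      using i has_rel_density_one_if_orbit_subset by metis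
  qed
  ultimately show ?thesis
    by blast
qed

end
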